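(* If $G\ne K_4$ is a connected subcubic graph with $C$ claw centers, then \[\operatorname{Z}(G) \le \alpha(G) + 1 + C.\]
   Context: All graphs are simple, finite and undirected. A graph is subcubic if it has maximum degree at most $3$. A claw is the graph $K_{1,3}$; a claw center of $G$ is a vertex that is the degree $3$ vertex of an induced claw of $G$. $\alpha(G)$ is the independence number of $G$. Zero forcing: given a set $B\subseteq V(G)$ of initially blue vertices (the rest white), if a blue vertex has exactly one white neighbor $w$, it can force $w$ to become blue; this rule is applied repeatedly. $B$ is a zero forcing set if all vertices can eventually become blue. $\operatorname{Z}(G)$ is the minimum cardinality of a zero forcing set of $G$. *)

theory Defs
  imports "Graph_Theory.Graph_Theory"
begin

text \<open>
  A simple finite undirected graph is modelled by the locale \<^locale>\<open>graph\<close>: finite,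
  symmetric, without loops and without parallel arcs. Every undirected edge is a pair of
  opposite arcs, so the undirected degree of a vertex is its out-degree.
\<close>

definition subcubic :: "('a, 'b) pre_digraph \<Rightarrow> bool" where
  "subcubic G \<longleftrightarrow> (\<forall>v \<in> verts G. out_degree G v \<le> 3)"

definition claw_center :: "('a, 'b) pre_digraph \<Rightarrow> 'a \<Rightarrow> bool" where
  "claw_center G v \<longleftrightarrow>
     (\<exists>S. S \<subseteq> verts G \<and> K\<^bsub>1,3\<^esub> (G \<restriction> S) \<and> v \<in> S \<and> out_degree (G \<restriction> S) v = 3)"

definition independent_set :: "('a, 'b) pre_digraph \<Rightarrow> 'a set \<Rightarrow> bool" where
  "independent_set G S \<longleftrightarrow> S \<subseteq> verts G \<and> (\<forall>u \<in> S. \<forall>v \<in> S. \<not> u \<rightarrow>\<^bsub>G\<^esub> v)"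

definition independence_number :: "('a, 'b) pre_digraph \<Rightarrow> nat" where
  "independence_number G = Max (card ` {S. independent_set G S})"

text \<open>One application of the colour change rule: the set of blue vertices grows from
  \<open>B\<close> to \<open>B'\<close> because some blue \<open>u\<close> has \<open>w\<close> as its only white neighbour.\<close>

definition force_step :: "('a, 'b) pre_digraph \<Rightarrow> 'a set \<Rightarrow> 'a set \<Rightarrow> bool" where
  "force_step G B B' \<longleftrightarrow>
     (\<exists>u \<in> B. \<exists>w. {v \<in> verts G - B. u \<rightarrow>\<^bsub>G\<^esub> v} = {w} \<and> B' = insert w B)"

definition zero_forcing_set :: "('a, 'b) pre_digraph \<Rightarrow> 'a set \<Rightarrow> bool" where
  "zero_forcing_set G B \<longleftrightarrow> B \<subseteq> verts G \<and> (force_step G)\<^sup>*\<^sup>* B (verts G)"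

definition zero_forcing_number :: "('a, 'b) pre_digraph \<Rightarrow> nat" where
  "zero_forcing_number G = Min (card ` {B. zero_forcing_set G B})"

text \<open>The maximum and the minimum above are taken over finite nonempty sets:\<close>

lemma independent_set_empty: "independent_set G {}"
  by (simp add: independent_set_def)

lemma zero_forcing_set_verts: "zero_forcing_set G (verts G)"
  by (simp add: zero_forcing_set_def)

lemma finite_independent_sets: "finite (verts G) \<Longrightarrow> finite {S. independent_set G S}"
  by (rule finite_subset[of _ "Pow (verts G)"]) (auto simp: independent_set_def)

lemma finite_zero_forcing_sets: "finite (verts G) \<Longrightarrow> finite {B. zero_forcing_set G B}"
  by (rule finite_subset[of _ "Pow (verts G)"]) (auto simp: zero_forcing_set_def)

end

theory Submission
  imports Defs
begin

text \<open>
  Colour a few vertices blue and force as long as possible. When forcing stalls, some blue vertex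
  has at least two white neighbours; call such a vertex active. If it also has a blue neighbour,
  then it has exactly two white ones, so colouring one of them by hand lets it force the other and
  be saturated from then on. Hence every stall costs one extra vertex, and these costs have to be
  charged to claw centers and to the members of an independent set.

  The key invariant is that no two active vertices are adjacent and every active vertex has a blue
  neighbour (\<open>tame\<close>). It survives because a newly blue vertex always has a saturated
  blue neighbour, which leaves no room in degree three for an active neighbour besides two white
  ones. At a stall at \<open>u\<close> with blue neighbour \<open>p\<close> and white neighbours
  \<open>w1\<close>, \<open>w2\<close>, the invariant makes \<open>p\<close> inactive, hence saturated,
  so \<open>p\<close> is adjacent to neither \<open>w1\<close> nor \<open>w2\<close>. Either \<open>u\<close>
  is a claw center, or \<open>w1\<close> and \<open>w2\<close> are adjacent. In the second case none of
  \<open>p\<close>, \<open>w1\<close>, \<open>w2\<close> is active after the stall, so no vertex at which a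
  later stall happens is adjacent to \<open>u\<close>: the stall vertices that are not claw centers
  are independent. The last step of the process yields one more independent vertex, namely a white
  vertex forced at the very end or a second active vertex, unless the process ends in a triangle
  with two vertices of degree two. This is \<open>supplement_exists\<close>.

  If \<open>s\<close> vertices are coloured at the start, this gives a zero forcing set of size at
  most \<open>s - 1\<close> plus what is charged, so \<open>s = 2\<close> is enough and
  \<open>s = 3\<close> needs one more independent vertex or an unused claw center.
  A vertex \<open>v\<close> of degree at most two gives \<open>s \<le> 2\<close>, and a triangle with two
  vertices of degree two supplies the missing independent vertex itself. In a cubic graph start
  with \<open>v\<close> and two of its neighbours, so that \<open>v\<close> forces the third one. If
  \<open>v\<close> is a claw center, it is never charged and makes up for the third vertex. If
  \<open>v\<close> is one of the two central vertices of a diamond, no neighbour of \<open>v\<close> is ever active, so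
  \<open>v\<close> can join the independent set. In the remaining case take \<open>v\<close> to be no
  cut vertex and \<open>v\<close>, \<open>a\<close>, \<open>b\<close> a triangle; of the neighbours of
  \<open>v\<close> only the third one, \<open>c\<close>, could ever be charged. But the process can
  always continue elsewhere, because a white set reachable from the blue one only through
  \<open>c\<close> would make \<open>v\<close> a cut vertex; so again \<open>v\<close> can join.
\<close>

section \<open>Neighbourhoods in a subcubic graph\<close>

locale subcubic_graph = graph G for G :: "('a, 'b) pre_digraph" (structure) +
  assumes subcubic: "subcubic G"
begin

definition nbrs :: "'a \<Rightarrow> 'a set" where
  "nbrs v = {w. v \<rightarrow>\<^bsub>G\<^esub> w}"

lemma nbrs_subset_verts: "nbrs v \<subseteq> verts G"
  by (auto simp: nbrs_def adj_in_verts)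

lemma finite_nbrs [simp]: "finite (nbrs v)"
  using nbrs_subset_verts finite_verts by (rule finite_subset)

lemma not_in_own_nbrs [simp]: "v \<notin> nbrs v"
  by (auto simp: nbrs_def dest: adj_not_same)

lemma in_nbrs_sym: "w \<in> nbrs v \<longleftrightarrow> v \<in> nbrs w"
  using sym_arcs by (auto simp: nbrs_def symmetric_def dest: symD)

lemma out_degree_eq_card_nbrs: "out_degree G v = card (nbrs v)"
proof -
  have "inj_on (head G) (out_arcs G v)"
    by (rule inj_onI) (auto simp: out_arcs_def arc_to_ends_def intro: no_multi_arcs)
  moreover have "head G ` out_arcs G v = nbrs v"
    by (auto simp: out_arcs_def nbrs_def arcs_ends_conv image_iff)
  ultimately show ?thesis
    unfolding out_degree_def by (metis card_image)
qed

lemma card_nbrs_le: "card (nbrs v) \<le> 3"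
proof (cases "v \<in> verts G")
  case True
  then show ?thesis using subcubic by (simp add: subcubic_def out_degree_eq_card_nbrs)
next
  case False
  then have "nbrs v = {}" using in_nbrs_sym nbrs_subset_verts by blast
  then show ?thesis by simp
qed

lemma claw_centerI:
  assumes "nbrs v = {a, b, c}" "a \<noteq> b" "a \<noteq> c" "b \<noteq> c"
    and "b \<notin> nbrs a" "c \<notin> nbrs a" "c \<notin> nbrs b"
  shows "claw_center G v"
proof -
  let ?S = "{v, a, b, c}"
  have v: "v \<in> verts G" and S: "?S \<subseteq> verts G" and va: "v \<noteq> a" "v \<noteq> b" "v \<noteq> c"
    using assms(1) nbrs_subset_verts in_nbrs_sym not_in_own_nbrs by blast+
  have ind: "induced_subgraph (G \<restriction> ?S) G" using S by (rule induced_induce)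
  interpret S: graph "G \<restriction> ?S"
    by (intro digraph.graphI digraphI_induced[OF ind] induced_graph_imp_symmetric[OF sym_arcs ind])
  have ends: "arcs_ends (G \<restriction> ?S) = {(x, y). x \<in> ?S \<and> y \<in> ?S \<and> y \<in> nbrs x}"
    by (auto simp: arcs_ends_conv nbrs_def)
  have "arcs_ends (G \<restriction> ?S) = {v} \<times> {a, b, c} \<union> {a, b, c} \<times> {v}"
    unfolding ends using assms in_nbrs_sym not_in_own_nbrs by blast
  moreover have "{v} \<inter> {a, b, c} = {}" "card {v} = 1" "card {a, b, c} = 3"
    using va assms by auto
  moreover have "verts (G \<restriction> ?S) = {v} \<union> {a, b, c}" by auto
  ultimately have "K\<^bsub>1,3\<^esub> (G \<restriction> ?S)"
    unfolding complete_bipartite_digraph_def using S.graph_axioms by blast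
  moreover have "out_arcs (G \<restriction> ?S) v = out_arcs G v"
    using assms(1) by (auto simp: out_arcs_def nbrs_def arcs_ends_conv image_iff)
  then have "out_degree (G \<restriction> ?S) v = 3"
    using out_degree_eq_card_nbrs[of v] assms by (simp add: out_degree_def)
  ultimately show ?thesis
    unfolding claw_center_def using S by blast
qed

lemma finite_claw_centers: "finite {v. claw_center G v}"
  by (rule finite_subset[OF _ finite_verts]) (auto simp: claw_center_def)

lemma complete_digraph_4I:
  assumes "card (verts G) = 4" "\<And>v. v \<in> verts G \<Longrightarrow> card (nbrs v) = 3"
  shows "K\<^bsub>4\<^esub> G"
proof -
  have "nbrs v = verts G - {v}" if "v \<in> verts G" for v
    using assms that nbrs_subset_verts[of v]
    by (intro card_subset_eq) auto
  then have "arcs_ends G = {(u, v). (u, v) \<in> verts G \<times> verts G \<and> u \<noteq> v}"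
    using adj_in_verts adj_not_same unfolding nbrs_def by blast
  then show ?thesis
    unfolding complete_digraph_def using graph_axioms assms(1) by simp
qed

section \<open>Connectivity by edge cuts\<close>

text \<open>A set of vertices is linked if it induces a connected subgraph. Connectivity enters
  the argument only through edges that leave a set of vertices, so it is expressed by cuts; this
  also spares the passage to subgraphs when a vertex is removed.\<close>

definition linked :: "'a set \<Rightarrow> bool" where
  "linked S \<longleftrightarrow> (\<forall>X. X \<noteq> {} \<longrightarrow> X \<subset> S \<longrightarrow> (\<exists>x\<in>X. nbrs x \<inter> (S - X) \<noteq> {}))"

lemma linked_verts:
  assumes "connected G"
  shows "linked (verts G)"
  unfolding linked_def
proof (intro allI impI)
  fix X assume X: "X \<noteq> {}" "X \<subset> verts G"
  then obtain x y where xy: "x \<in> X" "y \<in> verts G - X" by blast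
  then have "x \<rightarrow>\<^sup>*\<^bsub>G\<^esub> y"
    using symmetric_connected_imp_strongly_connected[OF sym_arcs assms] X
    unfolding strongly_connected_def by blast
  then have "y \<in> X" if no: "\<not> (\<exists>x\<in>X. nbrs x \<inter> (verts G - X) \<noteq> {})"
  proof (induct rule: reachable_induct)
    case base
    then show ?case using xy by simp
  next
    case (step x y)
    then show ?case using no adj_in_verts(2)[of x y] unfolding nbrs_def by blast
  qed
  then show "\<exists>x\<in>X. nbrs x \<inter> (verts G - X) \<noteq> {}" using xy by blast
qed

lemma linked_insert:
  assumes "linked S" "x \<in> S" "w \<in> nbrs x"
  shows "linked (insert w S)"
  unfolding linked_def
proof (intro allI impI)
  fix X assume X: "X \<noteq> {}" "X \<subset> insert w S"
  show "\<exists>x\<in>X. nbrs x \<inter> (insert w S - X) \<noteq> {}"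
  proof (cases "X \<inter> S = {}")
    case True
    then have "w \<in> X" "x \<notin> X" using X assms(2) by auto
    moreover have "x \<in> nbrs w" using assms(3) in_nbrs_sym by simp
    ultimately show ?thesis using assms(2) by auto
  next
    case ne: False
    show ?thesis
    proof (cases "S \<subseteq> X")
      case True
      then have "w \<notin> X" "x \<in> X" using X assms(2) by auto
      then show ?thesis using assms(3) by auto
    next
      case False
      then have "X \<inter> S \<subset> S" by auto
      then obtain y where "y \<in> X \<inter> S" "nbrs y \<inter> (S - X \<inter> S) \<noteq> {}"
        using assms(1) ne unfolding linked_def by meson
      then show ?thesis by (intro bexI[of _ y]) auto
    qed
  qed
qed

text \<open>Grow a linked proper subset as far as possible: connectivity would let it absorb one more
  vertex, so a largest one misses just a single vertex.\<close>

lemma obtain_non_cut_vertex: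
  assumes "linked (verts G)" "2 \<le> card (verts G)"
  obtains v where "v \<in> verts G" "linked (verts G - {v})"
proof -
  let ?F = "{S. S \<noteq> {} \<and> S \<subset> verts G \<and> linked S}"
  obtain r where r: "r \<in> verts G" using assms(2) by fastforce
  have "linked {r}" unfolding linked_def by (metis subset_singletonD psubset_imp_subset psubsetE)
  moreover have "{r} \<noteq> verts G" using assms(2) by (auto dest: arg_cong[where f = card])
  ultimately have ne: "?F \<noteq> {}" using r by auto
  have "finite ?F" by (rule finite_subset[of _ "Pow (verts G)"]) auto
  from finite_has_maximal[OF this ne]
  obtain S where S: "S \<noteq> {}" "S \<subset> verts G" "linked S"
    and max: "\<And>T. T \<noteq> {} \<and> T \<subset> verts G \<and> linked T \<Longrightarrow> S \<subseteq> T \<Longrightarrow> S = T"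
    by (elim bexE) (simp, metis)
  from assms(1)[unfolded linked_def, rule_format, OF S(1,2)]
  obtain x w where w: "x \<in> S" "w \<in> nbrs x" "w \<in> verts G - S" by auto
  have "\<not> insert w S \<subset> verts G"
    using max[of "insert w S"] linked_insert[OF S(3) w(1,2)] w(3) by auto
  then have "verts G - {w} = S" using S(2) w(3) by auto
  with S(3) w(3) show ?thesis using that by auto
qed

section \<open>Bounding the two parameters\<close>

lemma zero_forcing_number_le:
  assumes "zero_forcing_set G S"
  shows "zero_forcing_number G \<le> card S"
  unfolding zero_forcing_number_def
  using assms finite_zero_forcing_sets[OF finite_verts] by (intro Min_le) auto

lemma card_le_independence_number:
  assumes "independent_set G A"
  shows "card A \<le> independence_number G"
  unfolding independence_number_def
  using assms finite_independent_sets[OF finite_verts] by (intro Max_ge) auto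

lemma independent_set_finite: "independent_set G A \<Longrightarrow> finite A"
  unfolding independent_set_def using finite_verts finite_subset by blast

lemma independent_set_insert:
  assumes "independent_set G A" "v \<in> verts G" "nbrs v \<inter> A = {}"
  shows "independent_set G (insert v A)"
proof -
  have "\<not> v \<rightarrow>\<^bsub>G\<^esub> a" "\<not> a \<rightarrow>\<^bsub>G\<^esub> v" if "a \<in> A" for a
    using that assms(3) in_nbrs_sym[of v a] by (auto simp: nbrs_def)
  moreover have "\<not> v \<rightarrow>\<^bsub>G\<^esub> v" using not_in_own_nbrs[of v] by (simp add: nbrs_def)
  ultimately show ?thesis using assms(1,2) by (simp add: independent_set_def)
qed

lemma zero_forcing_number_bound:
  assumes "zero_forcing_set G S" "independent_set G A" "D \<subseteq> {v. claw_center G v}"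
    and "card S \<le> card A + 1 + card D"
  shows "zero_forcing_number G \<le> independence_number G + 1 + card {v. claw_center G v}"
  using zero_forcing_number_le[OF assms(1)] card_le_independence_number[OF assms(2)]
    card_mono[OF finite_claw_centers assms(3)] assms(4) by linarith

text \<open>A vertex that can be forced may be dropped from a zero forcing set. The case
  \<open>w \<in> S\<close> is included so that the lemma also applies when \<open>w\<close> has
  been coloured by hand anyway.\<close>

lemma zero_forcing_set_if_forces:
  assumes "zero_forcing_set G (insert w S)" "u \<in> S" "w \<in> nbrs u" "nbrs u - S \<subseteq> {w}"
  shows "zero_forcing_set G S"
proof (cases "w \<in> S")
  case True
  then show ?thesis using assms(1) by (simp add: insert_absorb)
next
  case False
  have "{v \<in> verts G - S. u \<rightarrow>\<^bsub>G\<^esub> v} = nbrs u - S"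
    using nbrs_subset_verts[of u] unfolding nbrs_def by blast
  also have "\<dots> = {w}" using assms False by blast
  finally have "force_step G S (insert w S)"
    unfolding force_step_def using assms(2) by blast
  then show ?thesis
    using assms(1) unfolding zero_forcing_set_def
    by (meson converse_rtranclp_into_rtranclp insert_subset)
qed

section \<open>Active vertices\<close>

definition active :: "'a set \<Rightarrow> 'a set" where
  "active B = {u \<in> B. 2 \<le> card (nbrs u - B)}"

text \<open>The vertices that can still be charged, now or later. The set shrinks as
  vertices turn blue, so a vertex that has become settled is safe from all later charges.\<close>

definition unsettled :: "'a set \<Rightarrow> 'a set" where
  "unsettled B = (verts G - B) \<union> active B"

text \<open>The blue neighbour of an active vertex guarantees that at most two of its neighbours
  are white.\<close>

definition tame :: "'a set \<Rightarrow> bool" where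
  "tame B \<longleftrightarrow> B \<subseteq> verts G \<and>
     (\<forall>u\<in>active B. nbrs u \<inter> B \<noteq> {} \<and> nbrs u \<inter> active B = {})"

lemma active_mono:
  assumes "B \<subseteq> B'" "u \<in> active B'" "u \<in> B"
  shows "u \<in> active B"
proof -
  have "card (nbrs u - B') \<le> card (nbrs u - B)"
    using assms(1) by (intro card_mono) auto
  then show ?thesis using assms by (auto simp: active_def)
qed

lemma unsettled_mono:
  assumes "B \<subseteq> B'" "B' \<subseteq> verts G"
  shows "unsettled B' \<subseteq> unsettled B"
proof
  fix u assume u: "u \<in> unsettled B'"
  show "u \<in> unsettled B"
  proof (cases "u \<in> B")
    case True
    then have "u \<in> active B'" using u assms by (auto simp: unsettled_def)
    then show ?thesis using active_mono[OF assms(1) _ True] by (simp add: unsettled_def)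
  next
    case False
    then show ?thesis
      using u assms by (auto simp: unsettled_def active_def)
  qed
qed

lemma card_nbrs_split: "card (nbrs u \<inter> B) + card (nbrs u - B) \<le> 3"
proof -
  have "card (nbrs u \<inter> B) + card (nbrs u - B) = card (nbrs u)"
    by (subst card_Un_disjoint[symmetric]) (auto intro: arg_cong[where f = card])
  then show ?thesis using card_nbrs_le[of u] by simp
qed

lemma active_blue_nbr_unique:
  assumes "u \<in> active B" "p \<in> nbrs u \<inter> B" "q \<in> nbrs u \<inter> B"
  shows "p = q"
proof (rule ccontr)
  assume "p \<noteq> q"
  then have "2 = card {p, q}" by simp
  also have "\<dots> \<le> card (nbrs u \<inter> B)" using assms by (intro card_mono) auto
  finally show False using card_nbrs_split[of u B] assms(1) by (simp add: active_def)
qed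

lemma not_active_if_two_blue:
  assumes "p \<in> nbrs u \<inter> B" "q \<in> nbrs u \<inter> B" "p \<noteq> q"
  shows "u \<notin> active B"
  using active_blue_nbr_unique assms by blast

lemma not_active_if_saturated: "nbrs u \<subseteq> B \<Longrightarrow> u \<notin> active B"
  by (simp add: active_def Diff_eq_empty_iff[THEN iffD2])

text \<open>A newly active vertex has two white neighbours, and its third neighbour is the
  saturated one given by the last hypothesis. So it has no active neighbour. Old vertices can only
  lose activity.\<close>

lemma tame_extend:
  assumes "tame B" "B \<subseteq> B'" "B' \<subseteq> verts G"
    and new: "\<And>w. w \<in> B' - B \<Longrightarrow> \<exists>f\<in>B'. w \<in> nbrs f \<and> nbrs f \<subseteq> B'"
  shows "tame B'"
proof -
  have no_new: "nbrs u \<inter> active B' = {}" if u: "u \<in> active B'" "u \<notin> B" for u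
  proof -
    obtain f where f: "f \<in> B'" "u \<in> nbrs f" "nbrs f \<subseteq> B'"
      using new[of u] u by (auto simp: active_def)
    have "q \<notin> active B'" if "q \<in> nbrs u" for q
    proof
      assume q: "q \<in> active B'"
      have "f \<in> nbrs u" using f in_nbrs_sym by simp
      then have "f = q"
        using active_blue_nbr_unique[OF u(1), of f q] f that q by (auto simp: active_def)
      then show False using not_active_if_saturated[OF f(3)] q by simp
    qed
    then show ?thesis by auto
  qed
  have "nbrs u \<inter> B' \<noteq> {} \<and> nbrs u \<inter> active B' = {}" if u: "u \<in> active B'" for u
  proof (cases "u \<in> B")
    case True
    then have uB: "u \<in> active B" using active_mono[OF assms(2) u] by simp
    have "q \<notin> active B'" if "q \<in> nbrs u" for q
    proof
      assume q: "q \<in> active B'"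
      show False
      proof (cases "q \<in> B")
        case True
        then have "q \<in> active B" using active_mono[OF assms(2) q] by simp
        then show False using assms(1) uB that by (auto simp: tame_def)
      next
        case False
        then show False using no_new[OF q] that u in_nbrs_sym by auto
      qed
    qed
    moreover have "nbrs u \<inter> B \<noteq> {}" using assms(1) uB by (auto simp: tame_def)
    ultimately show ?thesis using assms(2) by auto
  next
    case False
    then obtain f where "f \<in> B'" "u \<in> nbrs f"
      using new[of u] u by (auto simp: active_def)
    then have "f \<in> nbrs u \<inter> B'" using in_nbrs_sym by simp
    then show ?thesis using no_new[OF u False] by auto
  qed
  then show ?thesis using assms(3) by (simp add: tame_def)
qed

section \<open>Extending a tame blue set to a zero forcing set\<close>

text \<open>\<open>H\<close> is the set of vertices coloured by hand after \<open>B\<close>; the stalls are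
  charged to the independent set \<open>A\<close> and to the set \<open>D\<close> of claw centers.
  The number \<open>e\<close> is a guaranteed surplus of charged vertices over hand-coloured ones, and
  \<open>Q\<close> consists of vertices that \<open>A\<close> has to avoid.\<close>

definition supplement :: "'a set \<Rightarrow> 'a set \<Rightarrow> nat \<Rightarrow> 'a set \<Rightarrow> 'a set \<Rightarrow> 'a set \<Rightarrow> bool" where
  "supplement Q B e H A D \<longleftrightarrow>
     zero_forcing_set G (B \<union> H) \<and> independent_set G A \<and>
     A \<subseteq> unsettled B - Q \<and> D \<subseteq> unsettled B \<and> (\<forall>v\<in>D. claw_center G v) \<and>
     card H + e \<le> card A + card D"

definition stalled :: "'a set \<Rightarrow> bool" where
  "stalled B \<longleftrightarrow> (\<forall>v\<in>B. card (nbrs v - B) \<noteq> 1)"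

text \<open>Whatever the process does from \<open>B\<close> on, it never depends on a stall
  at a vertex of \<open>Q\<close>.\<close>

definition avoidable :: "'a set \<Rightarrow> 'a set \<Rightarrow> bool" where
  "avoidable Q B \<longleftrightarrow> (\<forall>B'. B \<subseteq> B' \<longrightarrow> B' \<subset> verts G \<longrightarrow> stalled B' \<longrightarrow> active B' - Q \<noteq> {})"

text \<open>For empty \<open>Q\<close> this excludes triangles with two vertices of degree two; in general
  it provides, when the process ends with \<open>w1\<close> and \<open>w2\<close>, a second active
  vertex outside \<open>Q\<close>.\<close>

definition triangles_leave :: "'a set \<Rightarrow> bool" where
  "triangles_leave Q \<longleftrightarrow> (\<forall>u w1 w2. w1 \<in> nbrs u \<longrightarrow> w2 \<in> nbrs u \<longrightarrow> w2 \<in> nbrs w1 \<longrightarrow>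
     (nbrs w1 \<union> nbrs w2) - {u, w1, w2} - Q \<noteq> {})"

lemma active_if_stalled:
  assumes "stalled B" "v \<in> B" "\<not> nbrs v \<subseteq> B"
  shows "v \<in> active B"
proof -
  have "card (nbrs v - B) \<noteq> 0" "card (nbrs v - B) \<noteq> 1"
    using assms by (auto simp: stalled_def)
  then have "2 \<le> card (nbrs v - B)" by linarith
  then show ?thesis using assms(2) by (simp add: active_def)
qed

text \<open>The blue neighbour \<open>p\<close> is not active by tameness, and in a stalled set this
  means that it is saturated. Hence the only possible edge among the neighbours of \<open>u\<close>
  joins the two white ones.\<close>

lemma stalled_active_obtain:
  assumes "tame B" "stalled B" "u \<in> active B"
  obtains p w1 w2 where "nbrs u = {p, w1, w2}" "p \<in> B" "w1 \<notin> B" "w2 \<notin> B" "w1 \<noteq> w2"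
    "nbrs p \<subseteq> B" "w2 \<in> nbrs w1 \<or> claw_center G u"
proof -
  have "nbrs u \<inter> B \<noteq> {}" "nbrs u \<inter> active B = {}"
    using assms(1,3) by (auto simp: tame_def)
  then obtain p where p: "p \<in> nbrs u" "p \<in> B" "p \<notin> active B" by blast
  have "q = p" if "q \<in> nbrs u \<inter> B" for q
    using active_blue_nbr_unique[OF assms(3) that] p by simp
  then have blue: "nbrs u \<inter> B = {p}" using p by fastforce
  then have "card (nbrs u - B) = 2"
    using card_nbrs_split[of u B] assms(3) by (simp add: active_def)
  then obtain w1 w2 where w: "nbrs u - B = {w1, w2}" "w1 \<noteq> w2"
    by (auto simp: card_2_iff)
  have N: "nbrs u = {p, w1, w2}" using blue w(1) by auto
  have pB: "nbrs p \<subseteq> B" using active_if_stalled[OF assms(2) p(2)] p(3) by blast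
  have w_white: "w1 \<notin> B" "w2 \<notin> B" using w(1) by auto
  have "claw_center G u" if "w2 \<notin> nbrs w1"
    using w_white p(2) pB that w(2) by (intro claw_centerI[OF N]) auto
  then show ?thesis using that[OF N p(2) w_white w(2) pB] by blast
qed

text \<open>Induction on the number of white vertices, adding the charges while returning from the
  end of the process. A forcing step changes nothing unless it is the last one, when the forced
  vertex is the surplus. At a stall the vertex \<open>u\<close> is charged; it is new because it is
  saturated afterwards, and if it is put into \<open>A\<close> it is not adjacent to later charges
  because none of its neighbours is unsettled any more.\<close>

lemma supplement_exists:
  assumes "tame B" "Q \<subseteq> B" "avoidable Q B"
    and "e = 0 \<or> e = 1 \<and> B \<noteq> verts G \<and> triangles_leave Q"
  shows "\<exists>H A D. supplement Q B e H A D"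
  using assms
proof (induction "card (verts G - B)" arbitrary: B rule: less_induct)
  case less
  have BV: "B \<subseteq> verts G" using less.prems by (simp add: tame_def)
  consider "B = verts G" | "B \<subset> verts G" "\<not> stalled B" | "B \<subset> verts G" "stalled B"
    using BV by blast
  then show ?case
  proof cases
    case 1
    then have "supplement Q B e {} {} {}"
      using less.prems(4) by (simp add: supplement_def zero_forcing_set_verts independent_set_empty)
    then show ?thesis by blast
  next
    case 2
    then obtain u w where u: "u \<in> B" "nbrs u - B = {w}"
      by (auto simp: stalled_def card_1_singleton_iff)
    then have w: "w \<in> nbrs u" "w \<notin> B" "w \<in> verts G" using nbrs_subset_verts by auto
    let ?B = "insert w B"
    have B': "?B \<subseteq> verts G" using w BV by simp
    have tame: "tame ?B"
      using u w by (intro tame_extend[OF less.prems(1) _ B']) (auto intro!: bexI[of _ u])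
    have pull: "zero_forcing_set G (B \<union> H)" if "zero_forcing_set G (?B \<union> H)" for H
      by (rule zero_forcing_set_if_forces[of w _ u]) (use that u w in auto)
    show ?thesis
    proof (cases "?B = verts G")
      case True
      have "independent_set G {w}"
        using w independent_set_insert[OF independent_set_empty] by simp
      moreover have "zero_forcing_set G (B \<union> {})"
        using pull[of "{}"] True by (simp add: zero_forcing_set_verts)
      moreover have "w \<in> unsettled B - Q" using w less.prems(2) by (auto simp: unsettled_def)
      ultimately have "supplement Q B e {} {w} {}"
        using less.prems(4) by (auto simp: supplement_def)
      then show ?thesis by blast
    next
      case False
      have "card (verts G - ?B) < card (verts G - B)"
        using w by (intro psubset_card_mono) auto
      moreover have "avoidable Q ?B" using less.prems(3) by (auto simp: avoidable_def)
      ultimately obtain H A D where "supplement Q ?B e H A D"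
        using less.hyps[of ?B] tame less.prems(2,4) False by blast
      then have "supplement Q B e H A D"
        using pull[of H] unsettled_mono[of B ?B] B' by (auto simp: supplement_def)
      then show ?thesis by blast
    qed
  next
    case 3
    then obtain u where u: "u \<in> active B" "u \<notin> Q"
      using less.prems(3) by (auto simp: avoidable_def)
    obtain p w1 w2 where N: "nbrs u = {p, w1, w2}" and p: "p \<in> B" "nbrs p \<subseteq> B"
      and w: "w1 \<notin> B" "w2 \<notin> B" "w1 \<noteq> w2" and claw: "w2 \<in> nbrs w1 \<or> claw_center G u"
      using stalled_active_obtain[OF less.prems(1) 3(2) u(1)] by metis
    have uB: "u \<in> B" using u by (simp add: active_def)
    have wV: "w1 \<in> verts G" "w2 \<in> verts G" using nbrs_subset_verts[of u] N by auto
    let ?B = "insert w1 (insert w2 B)"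
    have B': "?B \<subseteq> verts G" using wV BV by simp
    have tame: "tame ?B"
      using uB N p by (intro tame_extend[OF less.prems(1) _ B']) (auto intro!: bexI[of _ u])
    have pull: "zero_forcing_set G (B \<union> insert w1 H)" if "zero_forcing_set G (?B \<union> H)" for H
      by (rule zero_forcing_set_if_forces[of w2 _ u]) (use that uB N p in \<open>auto simp: insert_commute\<close>)
    have uU: "u \<in> unsettled B" using u by (simp add: unsettled_def)
    have u_ind: "independent_set G {u}"
      using uB BV independent_set_insert[OF independent_set_empty] by auto
    show ?thesis
    proof (cases "?B = verts G")
      case True
      have zf: "zero_forcing_set G (B \<union> {w1})"
        using pull[of "{}"] True by (simp add: zero_forcing_set_verts)
      \<comment> \<open>The process ends with this stall: besides \<open>u\<close> one more vertex is needed for the surplus.\<close>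
      consider "\<not> w2 \<in> nbrs w1" | "w2 \<in> nbrs w1" "e = 0"
        | "w2 \<in> nbrs w1" "e = 1" "triangles_leave Q" using less.prems(4) by auto
      then show ?thesis
      proof cases
        case 1
        have "independent_set G {w1}"
          using wV independent_set_insert[OF independent_set_empty] by simp
        moreover have "w1 \<in> unsettled B - Q" using w wV less.prems(2) by (auto simp: unsettled_def)
        ultimately have "supplement Q B e {w1} {w1} {u}"
          using zf less.prems(4) uU claw 1 by (auto simp: supplement_def)
        then show ?thesis by blast
      next
        case 2
        then have "supplement Q B e {w1} {u} {}"
          using zf u_ind u uU by (auto simp: supplement_def)
        then show ?thesis by blast
      next
        case 3
        \<comment> \<open>A blue neighbour of \<open>w1\<close> or \<open>w2\<close> is active like \<open>u\<close>, hence not adjacent to it.\<close>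
        have "(nbrs w1 \<union> nbrs w2) - {u, w1, w2} - Q \<noteq> {}"
          using 3(3) N 3(1) by (auto simp: triangles_leave_def)
        then obtain x where x: "x \<in> nbrs w1 \<union> nbrs w2" "x \<notin> {u, w1, w2}" "x \<notin> Q" by blast
        then have xB: "x \<in> B" using True nbrs_subset_verts by blast
        have "w1 \<in> nbrs x \<or> w2 \<in> nbrs x" using x in_nbrs_sym by blast
        then have x_act: "x \<in> active B"
          using active_if_stalled[OF \<open>stalled B\<close> xB] w by blast
        then have "nbrs x \<inter> {u} = {}"
          using less.prems(1) u(1) by (auto simp: tame_def)
        then have "independent_set G {x, u}"
          using independent_set_insert[OF u_ind] xB BV by blast
        then have "supplement Q B e {w1} {x, u} {}"
          using zf u uU x x_act 3 by (auto simp: supplement_def unsettled_def)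
        then show ?thesis by blast
      qed
    next
      case False
      have "card (verts G - ?B) < card (verts G - B)"
        using w wV by (intro psubset_card_mono) auto
      moreover have "avoidable Q ?B" using less.prems(3) by (auto simp: avoidable_def)
      ultimately obtain H A D where sup: "supplement Q ?B e H A D"
        using less.hyps[of ?B] tame less.prems(2,4) False by blast
      have mono: "unsettled ?B \<subseteq> unsettled B" using unsettled_mono[of B ?B] B' by auto
      have u_settled: "u \<notin> unsettled ?B"
        using uB N p not_active_if_saturated[of u ?B] by (auto simp: unsettled_def)
      have H: "card (insert w1 H) \<le> card H + 1"
        by (simp add: card_insert_le_m1 card_insert_if)
      have zf: "zero_forcing_set G (B \<union> insert w1 H)"
        using pull sup by (simp add: supplement_def)
      have fin: "finite A" "finite D"
        using sup independent_set_finite finite_subset[OF _ finite_claw_centers, of D]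
        by (auto simp: supplement_def)
      show ?thesis
      proof (cases "w2 \<in> nbrs w1")
        case False
        then have "claw_center G u" using claw by simp
        moreover have "u \<notin> D" using sup u_settled by (auto simp: supplement_def)
        ultimately have "supplement Q B e (insert w1 H) A (insert u D)"
          using sup zf H fin mono uU by (auto simp: supplement_def)
        then show ?thesis by blast
      next
        case True
        then have "w1 \<in> nbrs w2" using in_nbrs_sym by simp
        have uw: "u \<in> nbrs w1" "u \<in> nbrs w2" "u \<noteq> w1" "u \<noteq> w2"
          using in_nbrs_sym N uB w by auto
        have "p \<notin> unsettled ?B"
          using p not_active_if_saturated[of p ?B] by (auto simp: unsettled_def)
        moreover have "w1 \<notin> unsettled ?B"
          using not_active_if_two_blue[of u w1 ?B w2] uw True uB by (auto simp: unsettled_def)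
        moreover have "w2 \<notin> unsettled ?B"
          using not_active_if_two_blue[of u w2 ?B w1] uw \<open>w1 \<in> nbrs w2\<close> uB
          by (auto simp: unsettled_def)
        moreover have A: "A \<subseteq> unsettled ?B - Q" "independent_set G A"
          using sup by (auto simp: supplement_def)
        ultimately have "nbrs u \<inter> A = {}" using N by auto
        then have "independent_set G (insert u A)"
          using independent_set_insert[OF A(2)] uB BV by blast
        moreover have "u \<notin> A" using A u_settled by auto
        ultimately have "supplement Q B e (insert w1 H) (insert u A) D"
          using sup zf H fin mono uU u by (auto simp: supplement_def)
        then show ?thesis by blast
      qed
    qed
  qed
qed

section \<open>Choosing the initial blue vertices\<close>

lemma active_if_linked_stalled:
  assumes "linked (verts G)" "stalled B" "B \<noteq> {}" "B \<subset> verts G"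
  shows "active B \<noteq> {}"
proof -
  obtain x where "x \<in> B" "nbrs x \<inter> (verts G - B) \<noteq> {}"
    using assms(1,3,4) unfolding linked_def by meson
  then have "x \<in> active B" using active_if_stalled[OF assms(2)] by blast
  then show ?thesis by blast
qed

lemma avoidable_empty:
  assumes "linked (verts G)" "B \<noteq> {}"
  shows "avoidable {} B"
  unfolding avoidable_def using active_if_linked_stalled[OF assms(1)] assms(2) by auto

text \<open>Suppose that \<open>c\<close> is the only active vertex of a stalled set. Since
  \<open>v\<close> is not a cut vertex, some edge avoiding \<open>v\<close> leaves the blue vertices
  other than \<open>c\<close>. It does not end in a white vertex, so it ends in \<open>c\<close>.
  But then \<open>c\<close> has two blue neighbours and is not active.\<close>

lemma avoidable_only_exit:
  assumes "linked (verts G)" "linked (verts G - {v})"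
    and "v \<in> B" "c \<in> B" "c \<in> nbrs v" "a \<in> B" "a \<noteq> v" "a \<noteq> c" "nbrs v \<subseteq> B"
  shows "avoidable {c} B"
  unfolding avoidable_def
proof (intro allI impI)
  fix B' assume B': "B \<subseteq> B'" "B' \<subset> verts G" "stalled B'"
  have cv: "c \<noteq> v" "v \<in> nbrs c" using assms(5) in_nbrs_sym by auto
  show "active B' - {c} \<noteq> {}"
  proof
    assume only: "active B' - {c} = {}"
    let ?X = "B' - {v, c}"
    have "?X \<noteq> {}" using assms B' by auto
    moreover have "?X \<subset> verts G - {v}" using B' assms cv by auto
    ultimately obtain x where x: "x \<in> ?X" "nbrs x \<inter> (verts G - {v} - ?X) \<noteq> {}"
      using assms(2) unfolding linked_def by meson
    then obtain y where y: "y \<in> nbrs x" "y \<noteq> v" "y \<notin> ?X" by auto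
    have "x \<notin> active B'" using only x(1) by auto
    then have "nbrs x \<subseteq> B'" using active_if_stalled[OF B'(3)] x(1) by auto
    then have "y = c" using y by auto
    then have "x \<in> nbrs c" using y(1) in_nbrs_sym by simp
    then have "c \<notin> active B'"
      using not_active_if_two_blue[of x c B' v] cv x(1) assms(3) B'(1) by auto
    then have "active B' = {}" using only by auto
    then show False using active_if_linked_stalled[OF assms(1) B'(3) _ B'(2)] assms(3) B'(1) by auto
  qed
qed

text \<open>At the start, \<open>v\<close> is the blue neighbour that every active vertex needs.\<close>

lemma tameI:
  assumes "B \<subseteq> verts G" "v \<in> B" "active B \<subseteq> nbrs v"
    and "\<And>u w. u \<in> active B \<Longrightarrow> w \<in> active B \<Longrightarrow> w \<notin> nbrs u"
  shows "tame B"
proof -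
  have "v \<in> nbrs u \<inter> B" if "u \<in> active B" for u
    using that assms(2,3) in_nbrs_sym by auto
  moreover have "nbrs u \<inter> active B = {}" if "u \<in> active B" for u
    using that assms(4) by auto
  ultimately show ?thesis unfolding tame_def using assms(1) by fastforce
qed

text \<open>The centre \<open>v\<close> of the start can be added to the independent set, since all of its
  neighbours are settled or avoided.\<close>

lemma supplement_insert_settled:
  assumes "supplement Q B e H A D" "v \<in> B" "B \<subseteq> verts G" "nbrs v \<subseteq> B" "nbrs v \<inter> active B \<subseteq> Q"
  shows "independent_set G (insert v A)" "card (insert v A) = card A + 1"
proof -
  have A: "independent_set G A" "A \<subseteq> unsettled B - Q"
    using assms(1) by (auto simp: supplement_def)
  have "nbrs v \<inter> A = {}" using A(2) assms(4,5) by (auto simp: unsettled_def)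
  then show "independent_set G (insert v A)"
    using independent_set_insert[OF A(1)] assms(2,3) by auto
  have "v \<notin> A" using A(2) assms(2) not_active_if_saturated[OF assms(4)] by (auto simp: unsettled_def)
  then show "card (insert v A) = card A + 1" using independent_set_finite[OF A(1)] by simp
qed

text \<open>The accounting: \<open>S\<close> is coloured at the start, and \<open>k\<close> independent
  vertices and \<open>m\<close> claw centers are gained in addition to those charged.\<close>

lemma bound_if_supplement:
  assumes "supplement Q B e H A D" "zero_forcing_set G (S \<union> H)"
    and "independent_set G A'" "card A + k \<le> card A'"
    and "D' \<subseteq> {v. claw_center G v}" "card D + m \<le> card D'"
    and "card S \<le> e + 1 + k + m"
  shows "zero_forcing_number G \<le> independence_number G + 1 + card {v. claw_center G v}"
proof (rule zero_forcing_number_bound[OF assms(2,3,5)])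
  show "card (S \<union> H) \<le> card A' + 1 + card D'"
    using card_Un_le[of S H] assms(1,4,6,7) unfolding supplement_def by linarith
qed

text \<open>Both \<open>w1\<close> and \<open>w2\<close> have degree two. Colouring them forces
  \<open>u\<close>, after which the triangle is settled and \<open>w1\<close> is a free independent
  vertex. So no surplus is needed, which matters because the process may end in another such
  triangle.\<close>

lemma bound_pendant_triangle:
  assumes "linked (verts G)" "\<not> triangles_leave {}"
  shows "zero_forcing_number G \<le> independence_number G + 1 + card {v. claw_center G v}"
proof -
  obtain u w1 w2 where w: "w1 \<in> nbrs u" "w2 \<in> nbrs u" "w2 \<in> nbrs w1"
    and N: "nbrs w1 \<union> nbrs w2 \<subseteq> {u, w1, w2}"
    using assms(2) by (auto simp: triangles_leave_def)
  let ?B = "{u, w1, w2}"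
  have ne: "u \<noteq> w1" "u \<noteq> w2" "w1 \<noteq> w2" "u \<in> nbrs w1" using w in_nbrs_sym by auto
  have B: "?B \<subseteq> verts G" using w ne nbrs_subset_verts by auto
  have sat: "nbrs w1 \<subseteq> ?B" "nbrs w2 \<subseteq> ?B" using N by auto
  have "u \<notin> active ?B" using not_active_if_two_blue[of w1 u ?B w2] w ne by auto
  moreover have "active ?B \<subseteq> ?B" by (auto simp: active_def)
  ultimately have act: "active ?B = {}"
    using not_active_if_saturated[OF sat(1)] not_active_if_saturated[OF sat(2)] by auto
  then have "tame ?B" using tameI[OF B, of u] by simp
  then obtain H A D where sup: "supplement {} ?B 0 H A D"
    using supplement_exists[of ?B "{}" 0] avoidable_empty[OF assms(1), of ?B] by auto
  have "zero_forcing_set G ({w1, w2} \<union> H)"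
    by (rule zero_forcing_set_if_forces[of u _ w1])
      (use sup ne N in \<open>auto simp: supplement_def insert_commute\<close>)
  moreover have "independent_set G (insert w1 A)" "card (insert w1 A) = card A + 1"
    using supplement_insert_settled[OF sup _ B sat(1)] act by auto
  moreover have "D \<subseteq> {v. claw_center G v}" using sup by (auto simp: supplement_def)
  ultimately show ?thesis
    using ne by (intro bound_if_supplement[OF sup, of "{w1, w2}" "insert w1 A" 1 D 0]) auto
qed

lemma bound_small_degree:
  assumes "linked (verts G)" "triangles_leave {}" "v \<in> verts G" "card (nbrs v) \<le> 2"
  shows "zero_forcing_number G \<le> independence_number G + 1 + card {v. claw_center G v}"
proof -
  \<comment> \<open>The choice \<open>a = v\<close> treats the graph with a single vertex uniformly.\<close>
  obtain a where a: "a \<in> nbrs v \<or> a = v \<and> nbrs v = {}" by auto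
  let ?B = "{v, a}"
  have B: "?B \<subseteq> verts G" using a assms(3) nbrs_subset_verts by auto
  have "card (nbrs v - ?B) \<le> 1"
  proof (cases "a \<in> nbrs v")
    case True
    then have "card (nbrs v - ?B) \<le> card (nbrs v - {a})" by (intro card_mono) auto
    then show ?thesis using True assms(4) by simp
  qed (use a in auto)
  then have "v \<notin> active ?B" by (simp add: active_def)
  then have act: "active ?B \<subseteq> {a} - {v}" by (auto simp: active_def)
  have tame: "tame ?B"
  proof (rule tameI[OF B, of v])
    show "w \<notin> nbrs u" if "u \<in> active ?B" "w \<in> active ?B" for u w
    proof -
      have "u = a" "w = a" using act that by auto
      then show ?thesis by simp
    qed
  qed (use act a in auto)
  have cB: "card ?B \<le> 2" by (simp add: card_insert_if)
  show ?thesis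
  proof (cases "?B = verts G")
    case True
    have "independent_set G {v}"
      using independent_set_insert[OF independent_set_empty assms(3)] by simp
    then show ?thesis
      using zero_forcing_set_verts[of G] cB True[symmetric]
      by (intro zero_forcing_number_bound[of "verts G" "{v}" "{}"]) auto
  next
    case False
    obtain H A D where sup: "supplement {} ?B 1 H A D"
      using supplement_exists[OF tame, of "{}" 1] avoidable_empty[OF assms(1), of ?B] assms(2) False
      by auto
    then show ?thesis
      using cB by (intro bound_if_supplement[OF sup, of ?B A 0 D 0]) (auto simp: supplement_def)
  qed
qed

text \<open>The vertex \<open>v\<close> has only one white neighbour at the start, so it is never
  charged, although it is counted as a claw center. The two blue neighbours may both be active, but
  they are not adjacent.\<close>

lemma bound_claw:
  assumes "linked (verts G)" "triangles_leave {}"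
    and N: "nbrs v = {a, b, c}" "a \<noteq> b" "a \<noteq> c" "b \<noteq> c"
    and "b \<notin> nbrs a" "c \<notin> nbrs a" "c \<notin> nbrs b"
  shows "zero_forcing_number G \<le> independence_number G + 1 + card {v. claw_center G v}"
proof -
  let ?B = "{v, a, b}"
  have v: "v \<noteq> a" "v \<noteq> b" "v \<noteq> c" using N(1) not_in_own_nbrs[of v] by auto
  have "a \<in> nbrs v" using N(1) by simp
  then have B: "?B \<subseteq> verts G" "c \<in> verts G"
    using N(1) nbrs_subset_verts[of v] nbrs_subset_verts[of a] in_nbrs_sym[of a v] by auto
  have "nbrs v - ?B = {c}" using N v by auto
  then have v_act: "v \<notin> active ?B" by (simp add: active_def)
  then have act: "active ?B \<subseteq> {a, b}" by (auto simp: active_def)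
  have tame: "tame ?B"
  proof (rule tameI[OF B(1), of v])
    have "a \<notin> nbrs b" using assms(7) in_nbrs_sym by simp
    moreover have "u \<in> {a, b}" "w \<in> {a, b}" if "u \<in> active ?B" "w \<in> active ?B" for u w
      using act that by auto
    ultimately show "w \<notin> nbrs u" if "u \<in> active ?B" "w \<in> active ?B" for u w
      using that assms(7) by fastforce
  qed (use act N in auto)
  have "?B \<noteq> verts G" using B(2) N v by auto
  then obtain H A D where sup: "supplement {} ?B 1 H A D"
    using supplement_exists[OF tame, of "{}" 1] avoidable_empty[OF assms(1), of ?B] assms(2)
    by auto
  have D: "D \<subseteq> {v. claw_center G v}" "v \<notin> D"
    using sup v_act by (auto simp: supplement_def unsettled_def)
  then have "card (insert v D) = card D + 1"
    using finite_subset[OF _ finite_claw_centers] by simp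
  moreover have "claw_center G v" using claw_centerI N assms(7-9) by auto
  ultimately show ?thesis
    using D sup N v
    by (intro bound_if_supplement[OF sup, of ?B A 0 "insert v D" 1]) (auto simp: supplement_def)
qed

text \<open>All four vertices of the diamond are inactive once they are blue. They do not exhaust the
  graph, since otherwise it would be \<open>K\<^sub>4\<close>.\<close>

lemma bound_diamond:
  assumes "linked (verts G)" "triangles_leave {}"
    and cubic: "\<And>v. v \<in> verts G \<Longrightarrow> card (nbrs v) = 3" and "\<not> K\<^bsub>4\<^esub> G"
    and a: "a \<in> nbrs v" "nbrs v - {a} \<subseteq> nbrs a"
  shows "zero_forcing_number G \<le> independence_number G + 1 + card {v. claw_center G v}"
proof -
  have va: "v \<in> nbrs a" "v \<noteq> a" "a \<in> verts G"
    using a in_nbrs_sym[of a v] nbrs_subset_verts[of v] by auto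
  then have vV: "v \<in> verts G" using nbrs_subset_verts by auto
  then have "card (nbrs v - {a}) = 2" using cubic[of v] a by simp
  then obtain b d where bd: "nbrs v - {a} = {b, d}" "b \<noteq> d" by (auto simp: card_2_iff)
  have N: "nbrs v = {a, b, d}"
    using insert_Diff[OF a(1)] unfolding bd(1) by simp
  have ne: "a \<noteq> b" "a \<noteq> d" "v \<noteq> b" "v \<noteq> d"
    using bd(1) N not_in_own_nbrs[of v] by fastforce+
  let ?B = "{v, a, b, d}"
  have B: "?B \<subseteq> verts G" using N nbrs_subset_verts[of v] vV by auto
  have sat: "nbrs v \<subseteq> ?B" using N by auto
  have ab: "b \<in> nbrs a" "d \<in> nbrs a" using a(2) bd by auto
  then have ba: "a \<in> nbrs b" "a \<in> nbrs d" "v \<in> nbrs b" "v \<in> nbrs d"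
    using N in_nbrs_sym[of a] in_nbrs_sym[of v] by auto
  have "a \<notin> active ?B" using not_active_if_two_blue[of v a ?B b] va ab ne N by auto
  moreover have "b \<notin> active ?B" using not_active_if_two_blue[of v b ?B a] va ba ne by auto
  moreover have "d \<notin> active ?B" using not_active_if_two_blue[of v d ?B a] va ba ne by auto
  moreover have "active ?B \<subseteq> ?B" by (auto simp: active_def)
  ultimately have act: "active ?B = {}" using not_active_if_saturated[OF sat] by auto
  have tame: "tame ?B" using tameI[OF B, of v] act by simp
  have "?B \<noteq> verts G"
  proof
    assume V: "?B = verts G"
    have "card ?B = 4" using ne va bd(2) by simp
    then show False using complete_digraph_4I[OF _ cubic] V assms(4) by simp
  qed
  then obtain H A D where sup: "supplement {} ?B 1 H A D"
    using supplement_exists[OF tame, of "{}" 1] avoidable_empty[OF assms(1), of ?B] assms(2)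
    by auto
  have "zero_forcing_set G ({v, a, b} \<union> H)"
    by (rule zero_forcing_set_if_forces[of d _ v])
      (use sup N ne in \<open>auto simp: supplement_def insert_commute\<close>)
  moreover have "independent_set G (insert v A)" "card (insert v A) = card A + 1"
    using supplement_insert_settled[OF sup _ B sat] act by auto
  moreover have "D \<subseteq> {v. claw_center G v}" using sup by (auto simp: supplement_def)
  moreover have "card {v, a, b} = 3" using ne va by simp
  ultimately show ?thesis
    by (intro bound_if_supplement[OF sup, of "{v, a, b}" "insert v A" 1 D 0]) auto
qed

text \<open>Only \<open>c\<close> can be active at the start, and it is kept out of the independent set.
  Avoiding it costs nothing at the end of the process: if \<open>c\<close> were the only
  vertex outside a final triangle adjacent to \<open>w1\<close> or \<open>w2\<close>, then
  \<open>w1\<close> and \<open>w2\<close> would be the centres of a diamond.\<close>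

lemma bound_claw_free_diamond_free:
  assumes "linked (verts G)"
    and cubic: "\<And>v. v \<in> verts G \<Longrightarrow> card (nbrs v) = 3"
    and no_diamond: "\<And>v a. a \<in> nbrs v \<Longrightarrow> \<not> nbrs v - {a} \<subseteq> nbrs a"
    and v: "v \<in> verts G" "linked (verts G - {v})"
    and N: "nbrs v = {a, b, c}" and ab: "b \<in> nbrs a"
  shows "zero_forcing_number G \<le> independence_number G + 1 + card {v. claw_center G v}"
proof -
  have ne: "a \<noteq> b" "a \<noteq> c" "b \<noteq> c"
    using cubic[OF v(1)] N by (auto simp: card_insert_if split: if_splits)
  have va: "v \<noteq> a" "v \<noteq> b" "v \<noteq> c" using N not_in_own_nbrs[of v] by auto
  let ?B = "{v, a, b, c}"
  have B: "?B \<subseteq> verts G" using N nbrs_subset_verts[of v] v(1) by auto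
  have sat: "nbrs v \<subseteq> ?B" using N by auto
  have adj: "v \<in> nbrs a" "v \<in> nbrs b" "a \<in> nbrs b"
    using N ab in_nbrs_sym[of a b] in_nbrs_sym[of v] by auto
  have "a \<notin> active ?B" using not_active_if_two_blue[of v a ?B b] ab adj va by auto
  moreover have "b \<notin> active ?B" using not_active_if_two_blue[of v b ?B a] adj va by auto
  moreover have "active ?B \<subseteq> ?B" by (auto simp: active_def)
  ultimately have act: "active ?B \<subseteq> {c}" using not_active_if_saturated[OF sat] by auto
  have tame: "tame ?B"
  proof (rule tameI[OF B, of v])
    show "w \<notin> nbrs u" if "u \<in> active ?B" "w \<in> active ?B" for u w
    proof -
      have "u = c" "w = c" using act that by auto
      then show ?thesis by simp
    qed
  qed (use act N in auto)
  have "?B \<noteq> verts G"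
  proof
    assume V: "?B = verts G"
    have "nbrs a \<subseteq> {v, b, c}" using nbrs_subset_verts[of a] V not_in_own_nbrs[of a] by auto
    moreover have "card {v, b, c} = 3" using ne va by simp
    ultimately have "nbrs a = {v, b, c}"
      using cubic[of a] B by (intro card_subset_eq) auto
    then show False using no_diamond[of a v] N by auto
  qed
  moreover have "triangles_leave {c}"
    unfolding triangles_leave_def
  proof (intro allI impI notI)
    fix u w1 w2
    assume w: "w1 \<in> nbrs u" "w2 \<in> nbrs u" "w2 \<in> nbrs w1"
      and only: "(nbrs w1 \<union> nbrs w2) - {u, w1, w2} - {c} = {}"
    have wV: "w1 \<in> verts G" "w2 \<in> verts G" using w nbrs_subset_verts by auto
    have sub: "nbrs w1 \<subseteq> {u, w2, c}" "nbrs w2 \<subseteq> {u, w1, c}"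
      using only not_in_own_nbrs[of w1] not_in_own_nbrs[of w2] by auto
    have "card {u, w1, c} \<le> 3" by (simp add: card_insert_if)
    then have "nbrs w2 = {u, w1, c}"
      using sub(2) cubic[OF wV(2)] by (intro card_seteq) auto
    then show False using no_diamond[OF w(3)] sub(1) by auto
  qed
  moreover have "avoidable {c} ?B"
    using avoidable_only_exit[OF assms(1) v(2), of ?B c a] N va ne by auto
  ultimately obtain H A D where sup: "supplement {c} ?B 1 H A D"
    using supplement_exists[OF tame, of "{c}" 1] by auto
  have "zero_forcing_set G ({v, a, b} \<union> H)"
    by (rule zero_forcing_set_if_forces[of c _ v])
      (use sup N in \<open>auto simp: supplement_def insert_commute\<close>)
  moreover have "independent_set G (insert v A)" "card (insert v A) = card A + 1"
    using supplement_insert_settled[OF sup _ B sat] act by auto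
  moreover have "D \<subseteq> {v. claw_center G v}" using sup by (auto simp: supplement_def)
  moreover have "card {v, a, b} = 3" using ne va by simp
  ultimately show ?thesis
    by (intro bound_if_supplement[OF sup, of "{v, a, b}" "insert v A" 1 D 0]) auto
qed

lemma zero_forcing_number_le_independence_number:
  assumes "connected G" "\<not> K\<^bsub>4\<^esub> G"
  shows "zero_forcing_number G \<le> independence_number G + 1 + card {v. claw_center G v}"
proof -
  have linked: "linked (verts G)" using linked_verts[OF assms(1)] .
  consider (pendant) "\<not> triangles_leave {}"
    | (small) v where "triangles_leave {}" "v \<in> verts G" "card (nbrs v) \<le> 2"
    | (cubic) "triangles_leave {}" "\<And>v. v \<in> verts G \<Longrightarrow> card (nbrs v) = 3"
    using card_nbrs_le by (metis le_antisym not_less_eq_eq numeral_2_eq_2 numeral_3_eq_3)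
  then show ?thesis
  proof cases
    case pendant
    then show ?thesis using bound_pendant_triangle[OF linked] by simp
  next
    case small
    then show ?thesis using bound_small_degree[OF linked] by simp
  next
    case cubic
    show ?thesis
    proof (cases "\<exists>v a. a \<in> nbrs v \<and> nbrs v - {a} \<subseteq> nbrs a")
      case True
      then show ?thesis using bound_diamond[OF linked cubic assms(2)] by auto
    next
      case no_diamond: False
      have "verts G \<noteq> {}" using assms(1) by (auto simp: connected_conv)
      then obtain r where r: "r \<in> verts G" by auto
      have "card (nbrs r) \<le> card (verts G)"
        using nbrs_subset_verts by (intro card_mono) auto
      then have "2 \<le> card (verts G)" using cubic(2)[OF r] by simp
      then obtain v where v: "v \<in> verts G" "linked (verts G - {v})"
        using obtain_non_cut_vertex[OF linked] by auto
      obtain x y z where N: "nbrs v = {x, y, z}" "x \<noteq> y" "x \<noteq> z" "y \<noteq> z"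
        using cubic(2)[OF v(1)] by (auto simp: card_3_iff)
      have bound: ?thesis if "nbrs v = {a, b, c}" "b \<in> nbrs a" for a b c
        using bound_claw_free_diamond_free[OF linked cubic(2) _ v that] no_diamond by auto
      consider "y \<in> nbrs x" | "z \<in> nbrs x" | "z \<in> nbrs y"
        | "y \<notin> nbrs x" "z \<notin> nbrs x" "z \<notin> nbrs y" by auto
      then show ?thesis
      proof cases
        case 1
        then show ?thesis using bound[of x y z] N by simp
      next
        case 2
        then show ?thesis using bound[of x z y] N by (simp add: insert_commute)
      next
        case 3
        then show ?thesis using bound[of y z x] N by (simp add: insert_commute)
      next
        case 4
        then show ?thesis using bound_claw[OF linked cubic(1) N] by simp
      qed
    qed
  qed
qed

end

theorem theorem21:
  fixes G :: "('a, 'b) pre_digraph"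
  assumes "graph G"
    and "connected G"
    and "subcubic G"
    and "\<not> K\<^bsub>4\<^esub> G"
  shows "zero_forcing_number G \<le> independence_number G + 1 + card {v. claw_center G v}"
proof -
  interpret subcubic_graph G
    using assms by (simp add: subcubic_graph_def subcubic_graph_axioms_def)
  show ?thesis using zero_forcing_number_le_independence_number assms by simp
qed

end
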